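(* Any integrally closed residuated lattice that has a greatest element or a least element is integral.
   Context: A residuated lattice is an algebra $\langle A,\wedge,\vee,\cdot,\backslash,/,\mathrm{e}\rangle$ such that $\langle A,\wedge,\vee\rangle$ is a lattice, $\langle A,\cdot,\mathrm{e}\rangle$ is a monoid, and for all $a,b,c\in A$: $b\le a\backslash c \iff ab\le c\iff a\le c/b$. It is integrally closed if it satisfies $xy\le x\Rightarrow y\le \mathrm{e}$ and $yx\le x\Rightarrow y\le\mathrm{e}$, or equivalently, $x\backslash x\approx\mathrm{e}$ and $x/x\approx\mathrm{e}$. It is integral if it satisfies $x\le\mathrm{e}$. *)

theory Defs
  imports Main
begin

text \<open>
  The universe of the algebra is the whole type. The algebraic signature
  (meet, join, multiplication, the two residuals, unit) is rendered as
  \<open>inf\<close>, \<open>sup\<close>, \<open>*\<close>, \<open>left_residual\<close>, \<open>right_residual\<close>, \<open>1\<close>, where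
  \<open>left_residual a c\<close> is \<open>a\<close> under \<open>c\<close> and \<open>right_residual c b\<close> is \<open>c\<close> over \<open>b\<close>.
  Multiplication is not assumed commutative, and no bounds are assumed.
\<close>

class residuated_lattice = lattice + monoid_mult +
  fixes left_residual :: "'a \<Rightarrow> 'a \<Rightarrow> 'a"
    and right_residual :: "'a \<Rightarrow> 'a \<Rightarrow> 'a"
  assumes left_residuation: "b \<le> left_residual a c \<longleftrightarrow> a * b \<le> c"
    and right_residuation: "a * b \<le> c \<longleftrightarrow> a \<le> right_residual c b"

definition integrally_closed_rl :: "'a::residuated_lattice itself \<Rightarrow> bool" where
  "integrally_closed_rl _ \<longleftrightarrow>
     (\<forall>x y :: 'a. x * y \<le> x \<longrightarrow> y \<le> 1) \<and>
     (\<forall>x y :: 'a. y * x \<le> x \<longrightarrow> y \<le> 1)"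

definition integral_rl :: "'a::residuated_lattice itself \<Rightarrow> bool" where
  "integral_rl _ \<longleftrightarrow> (\<forall>x :: 'a. x \<le> 1)"

end

theory Submission
  imports Defs
begin

text \<open>A single \<open>z\<close> with \<open>z * x \<le> z\<close> for every \<open>x\<close>
  forces integrality, since integral closedness turns each such inequality into
  \<open>x \<le> 1\<close>. Either kind of bound is such a \<open>z\<close>.\<close>

theorem lemma2p1:
  assumes "integrally_closed_rl TYPE('a::residuated_lattice)"
    and "(\<exists>t::'a. \<forall>x. x \<le> t) \<or> (\<exists>b::'a. \<forall>x. b \<le> x)"
  shows "integral_rl TYPE('a)"
proof -
  \<comment> \<open>A greatest element works trivially. A least element \<open>b\<close> works
    because \<open>b \<le> right_residual b x\<close>, which residuation turns into
    \<open>b * x \<le> b\<close>.\<close>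
  obtain z :: 'a where z: "z * x \<le> z" for x
    using assms(2) by (meson right_residuation)
  have "x \<le> 1" for x :: 'a
    using assms(1) z[of x] unfolding integrally_closed_rl_def by blast
  then show ?thesis
    by (simp add: integral_rl_def)
qed

end
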